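(* Let $q$ be a prime power. A polynomial $f\in\mathbb{F}_q[x]$ is a shifting Costas polynomial if and only if $f(x)\equiv L(x^s)\pmod{x^q-x}$ for some linearized permutation polynomial $L(x)\in\mathbb{F}_q[x]$ and some positive integer $s$ with $\gcd(s,q-1)=1$.
   Context: Write $q=p^m$ with $p$ prime. A linearized permutation polynomial over $\mathbb{F}_q$ is a polynomial $L(x)=\sum_{j=0}^{m-1}c_jx^{p^j}\in\mathbb{F}_q[x]$ inducing a permutation of $\mathbb{F}_q$. A shifting Costas polynomial is a permutation polynomial $f\in\mathbb{F}_q[x]$ such that for every $d\in\mathbb{F}_q$ with $d\neq1$ there exists $a\in\mathbb{F}_q^*$ with $f(dx)-f(x)=f(ax)$ (as functions on $\mathbb{F}_q$, equivalently modulo $x^q-x$). *)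

theory Defs
  imports "HOL-Library.Cardinality" "HOL-Number_Theory.Cong" "HOL-Computational_Algebra.Polynomial"
begin

definition perm_poly :: "'a::{field,finite} poly \<Rightarrow> bool" where
  "perm_poly f \<longleftrightarrow> bij (poly f)"

text \<open>The parameters \<open>p\<close> and \<open>m\<close> are meant to satisfy \<open>CARD('a) = p ^ m\<close> with \<open>p\<close> prime.\<close>

definition linearized_perm_poly :: "nat \<Rightarrow> nat \<Rightarrow> 'a::{field,finite} poly \<Rightarrow> bool" where
  "linearized_perm_poly p m L \<longleftrightarrow>
     (\<exists>c. L = (\<Sum>j<m. monom (c j) (p ^ j))) \<and> perm_poly L"

definition shifting_costas_poly :: "'a::{field,finite} poly \<Rightarrow> bool" where
  "shifting_costas_poly f \<longleftrightarrow>
     perm_poly f \<and>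
     (\<forall>d. d \<noteq> 1 \<longrightarrow>
        (\<exists>a. a \<noteq> 0 \<and> (\<forall>x. poly f (d * x) - poly f x = poly f (a * x))))"

end

theory Submission
  imports Defs
begin

text \<open>
  Reduce \<open>f\<close> modulo \<open>x^q - x\<close> and compare coefficients in \<open>f(dx) - f(x) = f(ax)\<close>: every exponent \<open>s\<close>
  in the support of \<open>f\<close> satisfies \<open>d^s - 1 = a^s\<close>. Fix one such \<open>s\<close>. The map sending
  \<open>f(x)\<close> to \<open>x^s\<close> then turns \<open>f(ay) = f(dy) - f(y)\<close> into \<open>(ay)^s = (dy)^s - y^s\<close>, so it is additive;
  its kernel is trivial, so it is bijective, and its inverse is the required \<open>L\<close>.
\<close>

section \<open>Power identities and characteristic of a finite field\<close>

text \<open>Multiplication by a nonzero \<open>x\<close> permutes the nonzero elements; comparing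
  their products before and after gives \<open>x ^ (CARD('a) - 1) = 1\<close>.\<close>

lemma finite_field_power_CARD:
  fixes x :: "'a::{field,finite}"
  shows "x ^ CARD('a) = x"
proof (cases "x = 0")
  case False
  have "(\<Prod>y\<in>UNIV-{0}. y) = (\<Prod>y\<in>UNIV-{0}. x * y)"
    by (rule prod.reindex_bij_witness[of _ "\<lambda>y. x * y" "\<lambda>y. y / x"]) (use False in auto)
  also have "\<dots> = x ^ (CARD('a) - 1) * (\<Prod>y\<in>UNIV-{0}. y)"
    by (simp add: prod.distrib card_Diff_singleton)
  finally have "x ^ (CARD('a) - 1) = 1"
    by simp
  moreover have "CARD('a) = Suc (CARD('a) - 1)"
    by simp
  ultimately show ?thesis
    by (metis mult.right_neutral power_Suc)
qed (simp add: zero_power)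

lemma finite_field_power_CARD_minus_1:
  fixes x :: "'a::{field,finite}"
  assumes "x \<noteq> 0"
  shows "x ^ (CARD('a) - 1) = 1"
  using finite_field_power_CARD[of x] assms
  by (metis mult_cancel_left1 power_minus_mult zero_less_card_finite mult.commute)

text \<open>Translation by 1 permutes the field, so comparing the sums of all elements gives
  \<open>of_nat (CARD('a)) = 0\<close>. The characteristic is a prime, and it divides a power of
  \<open>p\<close>.\<close>

lemma CHAR_finite_field:
  assumes "prime p" and "CARD('a::{field,finite}) = p ^ m"
  shows "CHAR('a) = p"
proof -
  have "(\<Sum>x\<in>UNIV. x + 1) = (\<Sum>x\<in>(UNIV::'a set). x)"
    by (rule sum.reindex_bij_witness[of _ "\<lambda>x. x - 1" "\<lambda>x. x + 1"]) auto
  hence "of_nat (CARD('a)) = (0::'a)"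
    by (simp add: sum.distrib)
  hence "CHAR('a) dvd p ^ m"
    using assms by (simp only: of_nat_eq_0_iff_char_dvd)
  moreover have "prime CHAR('a)"
    by (intro prime_CHAR_semidom finite_imp_CHAR_pos) simp
  ultimately show ?thesis
    using assms(1) by (metis prime_dvd_power primes_dvd_imp_eq)
qed

section \<open>Polynomials as functions and reduction modulo \<open>x^q - x\<close>\<close>

lemma poly_eqI_CARD:
  fixes f g :: "'a::{field,finite} poly"
  assumes "\<And>x. poly f x = poly g x" "degree f < CARD('a)" "degree g < CARD('a)"
  shows "f = g"
  by (rule poly_eqI_degree[where A = UNIV]) (use assms in auto)

lemma degree_field_poly:
  assumes "q \<ge> 2"
  shows "degree (monom 1 q - monom 1 1 :: 'a::field poly) = q"
proof -
  have "degree (monom 1 q + - monom 1 1 :: 'a poly) = degree (monom 1 q :: 'a poly)"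
    using assms by (intro degree_add_eq_left) (simp add: degree_monom_eq)
  thus ?thesis by (simp add: degree_monom_eq)
qed

lemma poly_mod_field_poly:
  fixes f :: "'a::{field,finite} poly"
  shows "poly (f mod (monom 1 (CARD('a)) - monom 1 1)) x = poly f x"
proof -
  let ?h = "monom 1 (CARD('a)) - monom 1 1 :: 'a poly"
  have "poly f x = poly (f div ?h * ?h + f mod ?h) x"
    by (simp only: div_mult_mod_eq)
  also have "\<dots> = poly (f mod ?h) x"
    by (simp only: poly_add poly_mult poly_diff poly_monom finite_field_power_CARD) simp
  finally show ?thesis ..
qed

lemma CARD_field_ge_2: "CARD('a::{field,finite}) \<ge> 2"
proof -
  have "card {0, 1::'a} \<le> CARD('a)"
    by (rule card_mono) auto
  thus ?thesis by simp
qed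

lemma degree_mod_field_poly:
  fixes f :: "'a::{field,finite} poly"
  shows "degree (f mod (monom 1 (CARD('a)) - monom 1 1)) < CARD('a)"
proof -
  let ?h = "monom 1 (CARD('a)) - monom 1 1 :: 'a poly"
  have d: "degree ?h = CARD('a)"
    using CARD_field_ge_2 by (rule degree_field_poly)
  hence "?h \<noteq> 0"
    by (metis degree_0 zero_less_card_finite less_numeral_extra(3))
  thus ?thesis
    using degree_mod_less[of ?h f] d by auto
qed

text \<open>Remainders have degree below the field size, so their values determine them.\<close>

lemma cong_field_poly_iff:
  fixes f g :: "'a::{field,finite} poly"
  shows "[f = g] (mod (monom 1 (CARD('a)) - monom 1 1)) \<longleftrightarrow> (\<forall>x. poly f x = poly g x)"
  unfolding cong_def
  by (metis degree_mod_field_poly poly_eqI_CARD poly_mod_field_poly)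

text \<open>Interpolation: \<open>1 - (x - u) ^ (CARD('a) - 1)\<close> is the indicator function of
  the point \<open>u\<close>.\<close>

lemma ex_poly_fun:
  fixes h :: "'a::{field,finite} \<Rightarrow> 'a"
  shows "\<exists>P. \<forall>x. poly P x = h x"
proof -
  define P where "P = (\<Sum>u\<in>UNIV. smult (h u) (1 - [:- u, 1:] ^ (CARD('a) - 1)))"
  have "poly P x = h x" for x
  proof -
    have "1 - (x - u) ^ (CARD('a) - 1) = (if u = x then 1 else 0)" for u
      using finite_field_power_CARD_minus_1[of "x - u"] CARD_field_ge_2[where 'a='a]
      by (auto simp: zero_power)
    hence "poly P x = (\<Sum>u\<in>UNIV. h u * (if u = x then 1 else 0))"
      by (simp add: P_def poly_sum poly_power)
    also have "\<dots> = h x"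
      by (simp add: if_distrib cong: if_cong)
    finally show ?thesis .
  qed
  thus ?thesis by blast
qed

section \<open>Bijective power maps\<close>

text \<open>In the coprime case a Bezout coefficient \<open>u\<close> gives the inverse map.
  Conversely, let \<open>t\<close> be the gcd and \<open>n = (CARD('a) - 1) div t\<close>: nonzero
  \<open>s\<close>-th powers are roots of \<open>X^n - 1\<close>, and surjectivity gives
  \<open>t * n\<close> such roots, so \<open>t = 1\<close>.\<close>

lemma inj_power_iff:
  fixes s :: nat
  assumes "s > 0"
  shows "inj (\<lambda>x::'a::{field,finite}. x ^ s) \<longleftrightarrow> gcd s (CARD('a) - 1) = 1"
proof
  assume "gcd s (CARD('a) - 1) = 1"
  then obtain u v where uv: "s * u = (CARD('a) - 1) * v + 1"
    using bezout_nat[of s "CARD('a) - 1"] assms by auto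
  have "(x ^ s) ^ u = x" for x :: 'a
  proof (cases "x = 0")
    case True
    \<comment> \<open>Needed because \<open>0 ^ 0 = 1\<close>; the Bezout equation excludes
      \<open>u = 0\<close>.\<close>
    have "u > 0"
      using uv by (intro Nat.gr0I) auto
    with True assms show ?thesis by (simp add: zero_power)
  next
    case False
    have "(x ^ s) ^ u = (x ^ (CARD('a) - 1)) ^ v * x"
      by (simp only: power_mult[symmetric] uv power_add power_one_right)
    with False show ?thesis
      by (simp only: finite_field_power_CARD_minus_1[OF False] power_one mult_1_left)
  qed
  thus "inj (\<lambda>x::'a. x ^ s)"
    by (metis injI)
next
  assume "inj (\<lambda>x::'a. x ^ s)"
  hence surj: "surj (\<lambda>x::'a. x ^ s)"
    by (simp add: finite_UNIV_inj_surj)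
  define t where "t = gcd s (CARD('a) - 1)"
  define n where "n = (CARD('a) - 1) div t"
  define P where "P = monom 1 n - (1 :: 'a poly)"
  have q: "CARD('a) \<ge> 2" by (rule CARD_field_ge_2)
  have tn: "t * n = CARD('a) - 1" and "t dvd s"
    by (simp_all add: t_def n_def)
  hence "n > 0"
    using q by (intro Nat.gr0I) auto
  have root: "poly P y = 0" if "y \<noteq> 0" for y
  proof -
    obtain x where x: "y = x ^ s" using surj by blast
    hence "x \<noteq> 0" using that assms by (auto simp: zero_power)
    obtain r where "s = t * r" using \<open>t dvd s\<close> by blast
    hence "y ^ n = (x ^ (t * n)) ^ r"
      by (simp add: x power_mult[symmetric] mult_ac)
    hence "y ^ n = 1"
      by (simp only: tn finite_field_power_CARD_minus_1[OF \<open>x \<noteq> 0\<close>] power_one)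
    thus ?thesis
      by (simp add: P_def poly_monom)
  qed
  have "degree (monom 1 n + - (1 :: 'a poly)) = degree (monom (1 :: 'a) n)"
    using \<open>n > 0\<close> by (intro degree_add_eq_left) (simp add: degree_monom_eq)
  hence deg: "degree P = n"
    by (simp add: P_def degree_monom_eq)
  hence "P \<noteq> 0"
    using \<open>n > 0\<close> by auto
  hence "card {y. poly P y = 0} \<le> n"
    using card_poly_roots_bound deg by metis
  moreover have "card (UNIV - {0::'a}) \<le> card {y. poly P y = 0}"
    using root by (intro card_mono) auto
  ultimately have "t * n \<le> 1 * n"
    by (simp add: tn card_Diff_singleton)
  moreover have "t > 0"
    using tn q by (intro Nat.gr0I) auto
  ultimately have "t = 1"
    using \<open>n > 0\<close> by simp
  thus "gcd s (CARD('a) - 1) = 1"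
    by (simp only: t_def)
qed

section \<open>Additive maps and linearized polynomials\<close>

lemma additive_linearized:
  fixes c :: "nat \<Rightarrow> 'a::{field,finite}"
  assumes "prime p" and "CHAR('a) = p"
  shows "poly (\<Sum>j<m. monom (c j) (p ^ j)) (x + y) =
    poly (\<Sum>j<m. monom (c j) (p ^ j)) x + poly (\<Sum>j<m. monom (c j) (p ^ j)) y"
proof -
  have "(x + y) ^ (p ^ j) = x ^ (p ^ j) + y ^ (p ^ j)" for j
    using assms by (intro freshmans_dream') auto
  thus ?thesis
    by (simp add: poly_sum poly_monom algebra_simps sum.distrib)
qed

text \<open>
  Comparing derivatives in \<open>L(X + y) = L(X) + L(y)\<close> shows that \<open>L'\<close> is constant, so
  \<open>L = c X + G(X^p)\<close>, and \<open>G\<close> is again additive because the Frobenius map is onto.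
\<close>

lemma linearized_if_additive:
  fixes L :: "'a::{field,finite} poly"
  assumes "prime p" and "CHAR('a) = p" and "p ^ k \<le> CARD('a)"
    and "\<And>x y. poly L (x + y) = poly L x + poly L y" and "degree L < p ^ k"
  shows "\<exists>c. L = (\<Sum>j<k. monom (c j) (p ^ j))"
  using assms(3-5)
proof (induction k arbitrary: L)
  case 0
  \<comment> \<open>The degree is below \<open>p ^ 0 = 1\<close>, so \<open>L\<close> is a constant;
    additivity makes it 0, the empty sum.\<close>
  then obtain a where "L = [:a:]"
    by (auto elim: degree_eq_zeroE)
  moreover have "poly L 0 = 0"
    using "0.prems"(2)[of 0 0] by (metis add.right_neutral add_left_cancel)
  ultimately show ?case by simp
next
  case (Suc k)
  have p: "p \<ge> 2" using assms(1) by (rule prime_ge_2_nat)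
  have deg: "degree L < CARD('a)" using Suc.prems by linarith
  \<comment> \<open>Additivity is only a statement about values; the degree bound lifts it to a
    polynomial identity, which may be differentiated.\<close>
  have transl: "pcompose L [:y, 1:] = L + [:poly L y:]" for y
  proof (rule poly_eqI_CARD)
    show "poly (pcompose L [:y, 1:]) x = poly (L + [:poly L y:]) x" for x
      by (simp add: poly_pcompose Suc.prems(2)[symmetric] add.commute)
    show "degree (pcompose L [:y, 1:]) < CARD('a)"
      using deg by (simp add: degree_pcompose)
    show "degree (L + [:poly L y:]) < CARD('a)"
      using deg by (intro degree_add_less) auto
  qed
  have deriv: "pderiv L = [:coeff L 1:]"
  proof (rule poly_eqI_CARD)
    fix y
    have "pcompose (pderiv L) [:y, 1:] = pderiv L"
      using arg_cong[OF transl[of y], of pderiv]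
      by (simp add: pderiv_pcompose pderiv_add pderiv_pCons)
    hence "poly (pcompose (pderiv L) [:y, 1:]) 0 = poly (pderiv L) 0"
      by simp
    thus "poly (pderiv L) y = poly [:coeff L 1:] y"
      by (simp add: poly_pcompose poly_0_coeff_0 coeff_pderiv)
  next
    show "degree (pderiv L) < CARD('a)"
      using deg by (intro degree_lessI) (simp_all add: coeff_pderiv coeff_eq_0)
  qed auto
  \<comment> \<open>The coefficient of \<open>L'\<close> at \<open>i - 1\<close> is \<open>i\<close>
    times that of \<open>L\<close> at \<open>i\<close>, and \<open>i\<close> is invertible in
    characteristic \<open>p\<close>.\<close>
  have supp: "coeff L i = 0" if "\<not> p dvd i" "i \<noteq> 1" for i
  proof (cases i)
    case 0
    with that show ?thesis by simp
  next
    case (Suc j)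
    have "of_nat (Suc j) * coeff L (Suc j) = 0"
      using arg_cong[OF deriv, of "\<lambda>P. coeff P j"] that(2) Suc
      by (simp add: coeff_pderiv coeff_pCons split: nat.splits)
    moreover have "of_nat (Suc j) \<noteq> (0::'a)"
      using that Suc assms(2) by (simp only: of_nat_eq_0_iff_char_dvd) simp
    ultimately show ?thesis using Suc by simp
  qed
  define G where "G = (\<Sum>i<p ^ k. monom (coeff L (p * i)) i)"
  have coeff_G: "coeff G i = (if i < p ^ k then coeff L (p * i) else 0)" for i
    by (simp add: G_def coeff_sum)
  have deg_G: "degree G < p ^ k"
    using p by (intro degree_lessI) (auto simp: coeff_G)
  have L_eq: "L = monom (coeff L 1) 1 + (\<Sum>i<p ^ k. monom (coeff L (p * i)) (p * i))"
  proof (rule poly_eqI)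
    fix n
    have "(\<Sum>i<p ^ k. if p * i = n then coeff L (p * i) else 0) = (if p dvd n then coeff L n else 0)"
    proof (cases "p dvd n")
      case True
      then obtain r where r: "n = p * r" by blast
      have "(\<Sum>i<p ^ k. if p * i = n then coeff L (p * i) else 0) =
          (\<Sum>i<p ^ k. if r = i then coeff L (p * i) else 0)"
        using p r by (intro sum.cong) auto
      also have "\<dots> = (if r < p ^ k then coeff L n else 0)"
        by (simp add: r)
      also have "\<dots> = coeff L n"
      proof (cases "r < p ^ k")
        case False
        \<comment> \<open>The terms cut off in \<open>G\<close> lie beyond the degree of
          \<open>L\<close>.\<close>
        hence "p ^ Suc k \<le> n"
          by (simp add: r)
        with Suc.prems(3) have "coeff L n = 0"
          by (intro coeff_eq_0) linarith
        with False show ?thesis by simp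
      qed simp
      finally show ?thesis using True by simp
    next
      case False
      hence "p * i \<noteq> n" for i by auto
      with False show ?thesis by simp
    qed
    thus "coeff L n = coeff (monom (coeff L 1) 1 + (\<Sum>i<p ^ k. monom (coeff L (p * i)) (p * i))) n"
      using p supp[of n] by (auto simp: coeff_sum)
  qed
  have poly_L: "poly L x = coeff L 1 * x + poly G (x ^ p)" for x
    by (subst L_eq) (simp add: G_def poly_sum poly_monom power_mult)
  have frob: "(x + y) ^ p = x ^ p + y ^ p" for x y :: 'a
    using assms(1,2) by (intro freshmans_dream) auto
  have "inj (\<lambda>x::'a. x ^ p)"
  proof (rule injI)
    fix x y :: 'a assume "x ^ p = y ^ p"
    with frob[of "x - y" y] show "x = y" by simp
  qed
  hence surj: "surj (\<lambda>x::'a. x ^ p)"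
    by (simp add: finite_UNIV_inj_surj)
  \<comment> \<open>Subtract the additive linear term from \<open>L\<close>, evaluated at
    \<open>p\<close>-th roots of \<open>u\<close> and \<open>v\<close>.\<close>
  have "poly G (u + v) = poly G u + poly G v" for u v
  proof -
    obtain x y where "u = x ^ p" "v = y ^ p" using surj by (metis surjD)
    thus ?thesis
      using Suc.prems(2)[of x y] by (simp add: poly_L frob distrib_left)
  qed
  moreover have "p ^ k \<le> CARD('a)"
    using Suc.prems(1) p power_increasing[of k "Suc k" p] by linarith
  ultimately obtain c where c: "G = (\<Sum>j<k. monom (c j) (p ^ j))"
    using Suc.IH deg_G by blast
  \<comment> \<open>Substituting \<open>x ^ p\<close> raises each exponent \<open>p ^ j\<close> to
    \<open>p ^ Suc j\<close>, so the coefficients shift by one and the linear one fills index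
    0.\<close>
  define c' where "c' = case_nat (coeff L 1) c"
  have "L = (\<Sum>j<Suc k. monom (c' j) (p ^ j))"
  proof (rule poly_eqI_CARD)
    show "poly L x = poly (\<Sum>j<Suc k. monom (c' j) (p ^ j)) x" for x
      unfolding sum.lessThan_Suc_shift poly_L c
      by (simp add: c'_def poly_sum poly_monom power_mult)
    show "degree (\<Sum>j<Suc k. monom (c' j) (p ^ j)) < CARD('a)"
    proof (intro degree_sum_less)
      fix j assume "j \<in> {..<Suc k}"
      hence "p ^ j < p ^ Suc k"
        using p by (intro power_strict_increasing) auto
      thus "degree (monom (c' j) (p ^ j)) < CARD('a)"
        using degree_monom_le[of "c' j" "p ^ j"] Suc.prems(1) by linarith
    qed simp
  qed (fact deg)
  thus ?case by blast
qed

section \<open>Shifting Costas polynomials as additive bijections of power maps\<close>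

lemma shifting_costas_poly_support:
  fixes f :: "'a::{field,finite} poly"
  assumes "degree f < CARD('a)" and "coeff f s \<noteq> 0"
    and "\<And>x. poly f (d * x) - poly f x = poly f (a * x)"
  shows "d ^ s - 1 = a ^ s"
proof -
  have "pcompose f [:0, d:] - f = pcompose f [:0, a:]"
  proof (rule poly_eqI_CARD)
    show "poly (pcompose f [:0, d:] - f) x = poly (pcompose f [:0, a:]) x" for x
      using assms(3)[of x] by (simp add: poly_pcompose mult.commute)
    show "degree (pcompose f [:0, d:] - f) < CARD('a)"
      using assms(1) by (intro degree_diff_less) (auto simp: degree_pcompose)
    show "degree (pcompose f [:0, a:]) < CARD('a)"
      using assms(1) by (auto simp: degree_pcompose)
  qed
  hence "d ^ s * coeff f s - coeff f s = a ^ s * coeff f s"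
    by (metis coeff_diff coeff_pcompose_linear)
  hence "(d ^ s - 1) * coeff f s = a ^ s * coeff f s"
    by (simp add: algebra_simps)
  with assms(2) show ?thesis by simp
qed

lemma shifting_costas_poly_imp_additive:
  fixes f :: "'a::{field,finite} poly"
  assumes "shifting_costas_poly f"
  obtains s :: nat and h where "s > 0" "inj (\<lambda>x::'a. x ^ s)" "bij h"
    "\<And>x y. h (x + y) = h x + h y" "\<And>x. poly f x = h (x ^ s)"
proof -
  define F where "F = f mod (monom 1 (CARD('a)) - monom 1 1)"
  have F: "poly F x = poly f x" for x
    unfolding F_def by (rule poly_mod_field_poly)
  have deg: "degree F < CARD('a)"
    unfolding F_def by (rule degree_mod_field_poly)
  have bij: "bij (poly F)"
    and cost: "\<And>d. d \<noteq> 1 \<Longrightarrow> \<exists>a. a \<noteq> 0 \<and> (\<forall>x. poly F (d * x) - poly F x = poly F (a * x))"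
    using assms by (simp_all add: shifting_costas_poly_def perm_poly_def F bij_def inj_def surj_def)
  \<comment> \<open>Take \<open>d = 0\<close> and \<open>x = 0\<close>: the left side
    cancels.\<close>
  have F0: "poly F 0 = 0"
  proof -
    obtain a where "\<forall>x. poly F (0 * x) - poly F x = poly F (a * x)"
      using cost[of 0] zero_neq_one by blast
    from this[rule_format, of 0] show ?thesis
      by (simp only: mult_zero_left mult_zero_right diff_self)
  qed
  have "F \<noteq> 0"
    using bij injD[of "poly F" 0 1] by (auto simp: bij_def)
  then obtain s where s: "coeff F s \<noteq> 0"
    by (metis leading_coeff_0_iff)
  have "s > 0"
    using s F0 by (intro Nat.gr0I) (simp add: poly_0_coeff_0)
  \<comment> \<open>The map from \<open>F(x)\<close> to \<open>x ^ s\<close>, well defined since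
    \<open>F\<close> is bijective.\<close>
  define \<sigma> where "\<sigma> = (\<lambda>u. inv (poly F) u ^ s)"
  have \<sigma>_F: "\<sigma> (poly F x) = x ^ s" for x
    using bij by (simp add: \<sigma>_def bij_is_inj)
  have \<sigma>_diff: "\<sigma> (u - v) = \<sigma> u - \<sigma> v" for u v
  proof -
    obtain x y where xy: "u = poly F x" "v = poly F y"
      using bij by (metis bij_pointE)
    \<comment> \<open>The Costas condition applies to \<open>d = x / y\<close>; this leaves
      \<open>y = 0\<close> and \<open>x = y\<close> as separate cases, where
      \<open>0 ^ s = 0\<close> is used.\<close>
    have "x = (x / y) * y" if "y \<noteq> 0"
      using that by simp
    then consider "y = 0" | "x = y" | d where "d \<noteq> 1" "x = d * y"
      by (metis mult_1_left)
    thus ?thesis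
    proof cases
      case 1
      thus ?thesis using xy F0 \<sigma>_F[of 0] \<sigma>_F \<open>s > 0\<close> by (simp add: zero_power)
    next
      case 2
      thus ?thesis using xy F0 \<sigma>_F[of 0] \<open>s > 0\<close> by (simp add: zero_power)
    next
      case 3
      then obtain a where a: "\<And>x. poly F (d * x) - poly F x = poly F (a * x)"
        using cost by blast
      hence "d ^ s - 1 = a ^ s"
        using shifting_costas_poly_support deg s by blast
      have "\<sigma> (u - v) = a ^ s * y ^ s"
        by (simp add: xy 3 a \<sigma>_F power_mult_distrib)
      also have "\<dots> = \<sigma> u - \<sigma> v"
        by (simp add: xy 3 \<sigma>_F power_mult_distrib algebra_simps flip: \<open>d ^ s - 1 = a ^ s\<close>)
      finally show ?thesis .
    qed
  qed
  have "inj \<sigma>"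
  proof (rule injI)
    fix u v assume "\<sigma> u = \<sigma> v"
    hence "\<sigma> (u - v) = 0" by (simp add: \<sigma>_diff)
    hence "inv (poly F) (u - v) = 0" by (simp add: \<sigma>_def)
    hence "u - v = 0"
      using bij F0 by (metis bij_inv_eq_iff)
    thus "u = v" by simp
  qed
  hence bij_\<sigma>: "bij \<sigma>"
    by (simp add: bij_def finite_UNIV_inj_surj)
  show ?thesis
  proof (rule that[of s "inv \<sigma>"])
    \<comment> \<open>This composition is the power map itself.\<close>
    have "inj (\<sigma> \<circ> poly F)"
      using bij bij_\<sigma> by (simp add: bij_is_inj inj_compose)
    thus "inj (\<lambda>x::'a. x ^ s)"
      by (simp add: comp_def \<sigma>_F)
    show "inv \<sigma> (x + y) = inv \<sigma> x + inv \<sigma> y" for x y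
    proof -
      \<comment> \<open>Only differences are known to be preserved, so the sum is rewritten as
        one.\<close>
      have "\<sigma> (inv \<sigma> (x + y) - inv \<sigma> y) = x"
        by (simp add: \<sigma>_diff surj_f_inv_f[OF bij_is_surj[OF bij_\<sigma>]])
      thus ?thesis
        by (metis bij_\<sigma> bij_inv_eq_iff diff_add_cancel)
    qed
    show "poly f x = inv \<sigma> (x ^ s)" for x
      using bij_\<sigma> by (metis F \<sigma>_F bij_inv_eq_iff)
  qed (use bij_\<sigma> \<open>s > 0\<close> in \<open>simp_all add: bij_imp_bij_inv\<close>)
qed

lemma shifting_costas_poly_if_additive:
  fixes f :: "'a::{field,finite} poly" and s :: nat
  assumes "s > 0" "inj (\<lambda>x::'a. x ^ s)" "bij h"
    and add: "\<And>x y. h (x + y) = h x + h y"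
    and f: "\<And>x. poly f x = h (x ^ s)"
  shows "shifting_costas_poly f"
  unfolding shifting_costas_poly_def perm_poly_def
proof (intro conjI allI impI)
  have bij: "bij (\<lambda>x::'a. x ^ s)"
    using assms(2) by (simp add: bij_def finite_UNIV_inj_surj)
  have "poly f = h \<circ> (\<lambda>x. x ^ s)"
    by (simp add: f fun_eq_iff)
  thus "bij (poly f)"
    using bij assms(3) by (simp add: bij_comp)
  fix d :: 'a assume "d \<noteq> 1"
  hence "d ^ s \<noteq> 1 ^ s"
    using assms(2) by (meson injD)
  \<comment> \<open>The required \<open>a\<close> is the \<open>s\<close>-th root of
    \<open>d ^ s - 1\<close>, nonzero because \<open>d ^ s\<close> differs from 1.\<close>
  obtain a where a: "a ^ s = d ^ s - 1"
    using bij by (metis bij_pointE)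
  have "poly f (d * x) - poly f x = poly f (a * x)" for x
    using add[of "a ^ s * x ^ s" "x ^ s"]
    by (simp add: f power_mult_distrib a algebra_simps)
  moreover have "a \<noteq> 0"
    using a \<open>d ^ s \<noteq> 1 ^ s\<close> \<open>s > 0\<close> by (auto simp: zero_power)
  ultimately show "\<exists>a. a \<noteq> 0 \<and> (\<forall>x. poly f (d * x) - poly f x = poly f (a * x))"
    by blast
qed

theorem theorem7p4:
  fixes f :: "'a::{field,finite} poly" and p m q :: nat
  assumes "prime p" and "m > 0" and "q = p ^ m" and "CARD('a) = q"
  shows "shifting_costas_poly f \<longleftrightarrow>
    (\<exists>(L :: 'a poly) (s :: nat). linearized_perm_poly p m L \<and> s > 0 \<and> gcd s (q - 1) = 1 \<and>
       [f = pcompose L (monom 1 s)] (mod (monom 1 q - monom 1 1)))"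
proof -
  have char: "CHAR('a) = p"
    using assms by (intro CHAR_finite_field) auto
  have cong: "[f = pcompose L (monom 1 s)] (mod (monom 1 q - monom 1 1)) \<longleftrightarrow>
      (\<forall>x. poly f x = poly L (x ^ s))" for L and s :: nat
    using cong_field_poly_iff[of f "pcompose L (monom 1 s)"]
    by (simp add: assms(4) poly_pcompose poly_monom)
  show ?thesis
  proof
    assume "shifting_costas_poly f"
    then obtain s :: nat and h where s: "s > 0" "inj (\<lambda>x::'a. x ^ s)" and h: "bij h"
      and add: "\<And>x y. h (x + y) = h x + h y" and f: "\<And>x. poly f x = h (x ^ s)"
      using shifting_costas_poly_imp_additive by blast
    obtain P where P: "\<And>x. poly P x = h x"
      using ex_poly_fun by blast
    \<comment> \<open>Reduction brings the degree below \<open>p ^ m = q\<close>, as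
      \<open>linearized_if_additive\<close> with \<open>k = m\<close> demands.\<close>
    define L where "L = P mod (monom 1 (CARD('a)) - monom 1 1)"
    have L: "poly L = h"
      unfolding L_def by (intro ext) (simp only: poly_mod_field_poly P)
    have "degree L < CARD('a)"
      unfolding L_def by (rule degree_mod_field_poly)
    hence "\<exists>c. L = (\<Sum>j<m. monom (c j) (p ^ j))"
      using assms char add L by (intro linearized_if_additive) auto
    hence "linearized_perm_poly p m L"
      using h L by (simp add: linearized_perm_poly_def perm_poly_def)
    moreover have "gcd s (q - 1) = 1"
      using s inj_power_iff[of s, where 'a = 'a] assms(4) by simp
    ultimately show "\<exists>(L :: 'a poly) (s :: nat). linearized_perm_poly p m L \<and> s > 0 \<and>
        gcd s (q - 1) = 1 \<and> [f = pcompose L (monom 1 s)] (mod (monom 1 q - monom 1 1))"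
      using s f L cong by auto
  next
    assume "\<exists>(L :: 'a poly) (s :: nat). linearized_perm_poly p m L \<and> s > 0 \<and>
        gcd s (q - 1) = 1 \<and> [f = pcompose L (monom 1 s)] (mod (monom 1 q - monom 1 1))"
    then obtain L :: "'a poly" and s :: nat where L: "linearized_perm_poly p m L"
      and s: "s > 0" "gcd s (q - 1) = 1" and f: "\<And>x. poly f x = poly L (x ^ s)"
      using cong by auto
    show "shifting_costas_poly f"
    proof (rule shifting_costas_poly_if_additive[where h = "poly L" and s = s])
      show "inj (\<lambda>x::'a. x ^ s)"
        using s inj_power_iff[of s, where 'a = 'a] assms(4) by simp
      show "bij (poly L)" and "poly L (x + y) = poly L x + poly L y" for x y
        using L additive_linearized[OF assms(1) char]
        by (auto simp: linearized_perm_poly_def perm_poly_def)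
    qed (use s f in auto)
  qed
qed

end
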